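(* Let $N\ge 1$, $\hbar>0$, and let $\Sigma\in\mathcal M_Q^{\circ}$ be the covariance matrix of a faithful centered $N$-mode Gaussian state. Define the self-adjoint superoperator on $\operatorname{Sym}(2N)$ $$\mathcal S_\Sigma(G)=\Sigma G\Sigma+\frac{\hbar^2}{4}\Omega G\Omega .$$ Then for symmetric tangent vectors $X,Y\in\operatorname{Sym}(2N)$ the Bures metric is $$g_{\rm B}(X,Y)=\tfrac18\operatorname{Tr}\!\left[\mathcal S_\Sigma^{-1}(X)\,Y\right],$$ and, with the trace pairing $\langle P,X\rangle=\operatorname{Tr}(PX)$ between covectors and tangent vectors, the cometric operator is $8\mathcal S_\Sigma$, i.e. for every symmetric covector $P$, $$g_{\rm B}^*(\Sigma;P,P)=8\operatorname{Tr}(P\Sigma P\Sigma)+2\hbar^2\operatorname{Tr}(P\Omega P\Omega).$$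
   Context: $\operatorname{Sym}(n)$ is the space of real symmetric $n\times n$ matrices, and $\operatorname{Sym}_{++}(n)$ the positive definite ones. The symplectic form is $\Omega=\bigoplus_{k=1}^N\begin{pmatrix}0&1\\-1&0\end{pmatrix}$. By Williamson's theorem every $\Sigma\in\operatorname{Sym}_{++}(2N)$ can be written $\Sigma=S_W(\bigoplus_k\nu_k\mathbb 1_2)S_W^{\mathsf T}$ with $S_W\Omega S_W^{\mathsf T}=\Omega$; the $\nu_k>0$ are the symplectic eigenvalues. The quantum covariance domain is $\mathcal M_Q=\{\Sigma\in\operatorname{Sym}_{++}(2N):\Sigma+\frac{i\hbar}{2}\Omega\ge0\}$ (equivalently all $\nu_k\ge\hbar/2$), and $\mathcal M_Q^\circ$ is the subset with all $\nu_k>\hbar/2$. The Bures metric on covariance variations is defined from the Gaussian symmetric-logarithmic-derivative equation: for a smooth family $\Sigma(\theta)$, the real symmetric gain matrix $\mathfrak G_i$ solves $$\Sigma\mathfrak G_i\Sigma+\frac{\hbar^2}{4}\Omega\mathfrak G_i\Omega=\partial_i\Sigma,$$ the quantum Fisher information is $F_{ij}=\frac12\operatorname{Tr}(\mathfrak G_i\,\partial_j\Sigma)$, and the Bures metric is $g^{\rm B}_{ij}=\frac14F_{ij}$. The cometric $g^*_{\rm B}$ is the inverse quadratic form: $g^*_{\rm B}(\Sigma;P,P)=g_{\rm B}(X_P,X_P)$, where $X_P$ is the tangent vector with $g_{\rm B}(X_P,Y)=\operatorname{Tr}(PY)$ for all symmetric $Y$. *)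

theory Defs
  imports "HOL-Analysis.Analysis"
begin

text \<open>
  The modes are indexed by a finite type \<open>'n\<close>, so that N = CARD('n) is at least 1. The coordinate
  \<open>(k, 1)\<close> resp. \<open>(k, 2)\<close> is the first resp. second quadrature of mode \<open>k\<close>, and 2N-by-2N
  matrices are indexed by \<open>'n \<times> 2\<close>.
\<close>

type_synonym 'n mode_matrix = "real ^ ('n \<times> 2) ^ ('n \<times> 2)"

definition direct_sum :: "('n::finite \<Rightarrow> real ^ 2 ^ 2) \<Rightarrow> 'n mode_matrix" where
  "direct_sum B = (\<chi> i j. if fst i = fst j then B (fst i) $ snd i $ snd j else 0)"

definition Omega :: "'n::finite mode_matrix" where
  "Omega = direct_sum (\<lambda>k. vector [vector [0, 1], vector [-1, 0]])"

definition Sym :: "(real ^ 'm ^ 'm) set" where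
  "Sym = {A. transpose A = A}"

definition SymPD :: "(real ^ 'm::finite ^ 'm) set" where
  "SymPD = {A \<in> Sym. \<forall>x. x \<noteq> 0 \<longrightarrow> 0 < x \<bullet> (A *v x)}"

definition hermitian_psd :: "complex ^ 'm::finite ^ 'm \<Rightarrow> bool" where
  "hermitian_psd M \<longleftrightarrow>
     (\<forall>i j. M $ i $ j = cnj (M $ j $ i)) \<and>
     (\<forall>z. 0 \<le> Re (\<Sum>i\<in>UNIV. \<Sum>j\<in>UNIV. cnj (z $ i) * M $ i $ j * z $ j))"

definition MQ :: "real \<Rightarrow> 'n::finite mode_matrix set" where
  "MQ hbar = {\<Sigma> \<in> SymPD. hermitian_psd
     (\<chi> i j. complex_of_real (\<Sigma> $ i $ j) + \<i> * complex_of_real (hbar / 2 * Omega $ i $ j))}"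

text \<open>
  \<open>symplectic_eigenvalues \<Sigma> \<nu>\<close>: the family \<open>\<nu>\<close> consists of the symplectic eigenvalues of \<open>\<Sigma>\<close>,
  listed with multiplicity. By Williamson's theorem such a \<open>\<nu>\<close> exists for every positive definite
  \<open>\<Sigma>\<close>, and it is unique up to a permutation of the modes. Hence the existential quantifier in
  \<open>MQ_int\<close> could equally be a universal one.
\<close>

definition symplectic_eigenvalues :: "'n::finite mode_matrix \<Rightarrow> ('n \<Rightarrow> real) \<Rightarrow> bool" where
  "symplectic_eigenvalues \<Sigma> \<nu> \<longleftrightarrow> (\<forall>k. 0 < \<nu> k) \<and>
     (\<exists>W. W ** Omega ** transpose W = Omega \<and>
          \<Sigma> = W ** direct_sum (\<lambda>k. \<nu> k *\<^sub>R mat 1) ** transpose W)"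

definition MQ_int :: "real \<Rightarrow> 'n::finite mode_matrix set" where
  "MQ_int hbar = {\<Sigma> \<in> MQ hbar. \<exists>\<nu>. symplectic_eigenvalues \<Sigma> \<nu> \<and> (\<forall>k. hbar / 2 < \<nu> k)}"

definition partial_deriv ::
  "'p::finite \<Rightarrow> (real ^ 'p \<Rightarrow> 'b::real_normed_vector) \<Rightarrow> real ^ 'p \<Rightarrow> 'b" where
  "partial_deriv i f \<theta> = vector_derivative (\<lambda>t. f (\<theta> + t *\<^sub>R axis i 1)) (at 0)"

text \<open>\<open>Ck_on k U f\<close> and \<open>smooth_on U f\<close> are meant for open \<open>U\<close> only.\<close>

primrec Ck_on ::
  "nat \<Rightarrow> (real ^ 'p::finite) set \<Rightarrow> (real ^ 'p \<Rightarrow> 'b::real_normed_vector) \<Rightarrow> bool" where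
  "Ck_on 0 U f \<longleftrightarrow> continuous_on U f"
| "Ck_on (Suc k) U f \<longleftrightarrow> f differentiable_on U \<and> (\<forall>i. Ck_on k U (partial_deriv i f))"

definition smooth_on ::
  "(real ^ 'p::finite) set \<Rightarrow> (real ^ 'p \<Rightarrow> 'b::real_normed_vector) \<Rightarrow> bool" where
  "smooth_on U f \<longleftrightarrow> (\<forall>k. Ck_on k U f)"

definition sld_op :: "real \<Rightarrow> 'n::finite mode_matrix \<Rightarrow> 'n mode_matrix \<Rightarrow> 'n mode_matrix" where
  "sld_op hbar \<Sigma> G = \<Sigma> ** G ** \<Sigma> + (hbar\<^sup>2 / 4) *\<^sub>R (Omega ** G ** Omega)"

definition gain ::
  "real \<Rightarrow> (real ^ 'p::finite \<Rightarrow> 'n::finite mode_matrix) \<Rightarrow> real ^ 'p \<Rightarrow> 'p \<Rightarrow> 'n mode_matrix" where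
  "gain hbar \<sigma> \<theta> i = (THE G. G \<in> Sym \<and> sld_op hbar (\<sigma> \<theta>) G = partial_deriv i \<sigma> \<theta>)"

definition qfi ::
  "real \<Rightarrow> (real ^ 'p::finite \<Rightarrow> 'n::finite mode_matrix) \<Rightarrow> real ^ 'p \<Rightarrow> 'p \<Rightarrow> 'p \<Rightarrow> real" where
  "qfi hbar \<sigma> \<theta> i j = 1 / 2 * trace (gain hbar \<sigma> \<theta> i ** partial_deriv j \<sigma> \<theta>)"

definition bures_components ::
  "real \<Rightarrow> (real ^ 'p::finite \<Rightarrow> 'n::finite mode_matrix) \<Rightarrow> real ^ 'p \<Rightarrow> 'p \<Rightarrow> 'p \<Rightarrow> real" where
  "bures_components hbar \<sigma> \<theta> i j = 1 / 4 * qfi hbar \<sigma> \<theta> i j"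

text \<open>
  The Bures form on tangent vectors \<open>X\<close>, \<open>Y\<close> at \<open>\<Sigma>\<close> is the (1,2) component for the affine
  two-parameter family through \<open>\<Sigma>\<close> with partial derivatives \<open>X\<close>, \<open>Y\<close>; the components depend
  only on the value and the first derivatives of the family at the base point.
\<close>

definition bures_metric ::
  "real \<Rightarrow> 'n::finite mode_matrix \<Rightarrow> 'n mode_matrix \<Rightarrow> 'n mode_matrix \<Rightarrow> real" where
  "bures_metric hbar \<Sigma> X Y =
     bures_components hbar (\<lambda>\<theta> :: real ^ 2. \<Sigma> + \<theta> $ 1 *\<^sub>R X + \<theta> $ 2 *\<^sub>R Y) 0 1 2"

definition is_bures_dual ::
  "real \<Rightarrow> 'n::finite mode_matrix \<Rightarrow> 'n mode_matrix \<Rightarrow> 'n mode_matrix \<Rightarrow> bool" where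
  "is_bures_dual hbar \<Sigma> P X \<longleftrightarrow>
     X \<in> Sym \<and> (\<forall>Y\<in>Sym. bures_metric hbar \<Sigma> X Y = trace (P ** Y))"

definition bures_dual :: "real \<Rightarrow> 'n::finite mode_matrix \<Rightarrow> 'n mode_matrix \<Rightarrow> 'n mode_matrix" where
  "bures_dual hbar \<Sigma> P = (THE X. is_bures_dual hbar \<Sigma> P X)"

definition bures_cometric ::
  "real \<Rightarrow> 'n::finite mode_matrix \<Rightarrow> 'n mode_matrix \<Rightarrow> 'n mode_matrix \<Rightarrow> real" where
  "bures_cometric hbar \<Sigma> P Q =
     bures_metric hbar \<Sigma> (bures_dual hbar \<Sigma> P) (bures_dual hbar \<Sigma> Q)"

end

(* In Williamson coordinates \<Sigma> = W D W^T, the equation sld_op G = 0 turns into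
   D H D + (hbar^2/4) Omega H Omega = 0 for H = W^T G W. Since Omega permutes the entries up to sign,
   this pairs up the entries of each 2-by-2 block (k, l) of H, and applying it twice multiplies
   an entry by ((hbar^2/4) / (\<nu>_k \<nu>_l))^2 < 1, so H = 0. Thus sld_op is injective, hence bijective,
   and as it commutes with transposition it restricts to a bijection of the symmetric matrices. *)

theory Submission
  imports Defs
begin

section \<open>Matrix algebra and the entrywise action of the symplectic form\<close>

lemma matrix_add_rdistrib: "(A + B) ** C = A ** C + B ** (C :: 'a::semiring_1 ^ 'p ^ 'm)"
  by (simp add: vec_eq_iff matrix_matrix_mult_def algebra_simps sum.distrib)

lemma matrix_sub_rdistrib: "(A - B) ** C = A ** C - B ** (C :: 'a::ring_1 ^ 'p ^ 'm)"
  by (simp add: vec_eq_iff matrix_matrix_mult_def algebra_simps sum_subtractf)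

lemma matrix_mult_minus_left: "(- A) ** B = - (A ** (B :: 'a::ring_1 ^ 'p ^ 'm))"
  by (simp add: vec_eq_iff matrix_matrix_mult_def sum_negf)

lemma matrix_mult_minus_right: "A ** (- B) = - (A ** (B :: 'a::ring_1 ^ 'p ^ 'm))"
  by (simp add: vec_eq_iff matrix_matrix_mult_def sum_negf)

lemma transpose_add: "transpose (A + B) = transpose A + transpose B"
  by (simp add: vec_eq_iff transpose_def)

lemma Omega_nth:
  "Omega $ (k, a) $ (l, b) = (if k = l then if a = 1 \<and> b = 2 then 1 else if a = 2 \<and> b = 1 then -1 else 0 else 0)"
  using exhaust_2[of a] exhaust_2[of b] unfolding Omega_def direct_sum_def by auto

lemma sum_prod_2: "(\<Sum>j\<in>(UNIV :: ('n::finite \<times> 2) set). f j) = (\<Sum>k\<in>UNIV. f (k, 1) + f (k, 2))"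
  using sum.cartesian_product[of "\<lambda>k a. f (k, a)" UNIV UNIV]
  by (simp add: sum_2)

text \<open>Together with the column rules in \<open>mult_Omega_nth\<close>, these turn
  \<open>Omega ** H ** Omega\<close> into a signed exchange of entries within each 2-by-2 mode block
  of \<open>H\<close>.\<close>

lemma Omega_mult_nth:
  "(Omega ** H) $ (k, 1) $ j = H $ (k, 2) $ j" 
  "(Omega ** H) $ (k, 2) $ j = - H $ (k, 1) $ j"
  by (simp_all add: matrix_matrix_mult_def sum_prod_2 Omega_nth if_distrib[of "\<lambda>c. c * _"] cong: if_cong)

lemma mult_Omega_nth:
  "(H ** Omega) $ i $ (l, 1) = - H $ i $ (l, 2)" 
  "(H ** Omega) $ i $ (l, 2) = H $ i $ (l, 1)"
  by (simp_all add: matrix_matrix_mult_def sum_prod_2 Omega_nth if_distrib[of "\<lambda>c. _ * c"] cong: if_cong)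

lemma direct_sum_scaled_id_nth:
  "direct_sum (\<lambda>k. \<nu> k *\<^sub>R mat 1) $ i $ j = (if i = j then \<nu> (fst i) else 0)"
  by (auto simp: direct_sum_def mat_def prod_eq_iff)

lemma diagonal_mult_nth:
  "(direct_sum (\<lambda>k. \<nu> k *\<^sub>R mat 1) ** H) $ i $ j = \<nu> (fst i) * H $ i $ j" 
  "(H ** direct_sum (\<lambda>k. \<nu> k *\<^sub>R mat 1)) $ i $ j = \<nu> (fst j) * H $ i $ j"
  by (simp_all add: matrix_matrix_mult_def direct_sum_scaled_id_nth 
     if_distrib[of "\<lambda>c. _ * c"] if_distrib[of "\<lambda>c. c * _"] cong: if_cong)

lemma Omega_Omega: "Omega ** Omega = - mat 1"
proof -
  have "(Omega ** Omega) $ (k,a) $ (l,b) = (- mat 1 :: 'a mode_matrix) $ (k,a) $ (l,b)" for k l a b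
    using exhaust_2[of a] exhaust_2[of b] by (auto simp: Omega_mult_nth Omega_nth mat_def)
  then show ?thesis by (auto simp: vec_eq_iff)
qed

lemma transpose_Omega: "transpose Omega = - Omega"
proof -
  have "transpose Omega $ (k,a) $ (l,b) = (- Omega :: 'a mode_matrix) $ (k,a) $ (l,b)" for k l a b
    using exhaust_2[of a] exhaust_2[of b] by (auto simp: transpose_def Omega_nth)
  then show ?thesis by (auto simp: vec_eq_iff)
qed

section \<open>Bijectivity of the logarithmic-derivative operator\<close>

lemma linear_sld_op: "linear (sld_op hbar \<Sigma>)"
  by (rule linearI)
    (simp_all add: sld_op_def matrix_add_ldistrib matrix_add_rdistrib matrix_scalar_ac 
       scalar_matrix_assoc[symmetric] algebra_simps)

text \<open>Transposition reverses the order of the factors, and the two signs from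
  \<open>transpose Omega = - Omega\<close> cancel.\<close>

lemma transpose_sld_op:
  assumes "\<Sigma> \<in> Sym"
  shows "transpose (sld_op hbar \<Sigma> G) = sld_op hbar \<Sigma> (transpose G)"
proof -
  have "transpose \<Sigma> = \<Sigma>" using assms by (simp add: Sym_def)
  then show ?thesis
    by (simp add: sld_op_def transpose_add transpose_scalar matrix_transpose_mul transpose_Omega
      matrix_mul_assoc matrix_mult_minus_left matrix_mult_minus_right)
qed

lemma inj_sld_op_diagonal:
  assumes "\<And>k. hbar / 2 < \<nu> k" "0 < hbar" 
    and zero: "sld_op hbar (direct_sum (\<lambda>k. \<nu> k *\<^sub>R mat 1)) H = 0"
  shows "H = (0 :: 'n::finite mode_matrix)"
proof -
  define c where "c = hbar\<^sup>2 / 4"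
  \<comment> \<open>Both factors exceed \<open>hbar / 2\<close>, which is positive, so their product
    exceeds its square. The strict bound on the symplectic eigenvalues enters here.\<close>
  have gt: "c < \<nu> k * \<nu> l" for k l
    using mult_strict_mono'[OF assms(1)[of k] assms(1)[of l]] assms(2)
    by (simp add: c_def power2_eq_square)
  have c0: "0 < c" using assms(2) by (simp add: c_def)
  have nth: "\<nu> k * \<nu> l * H $ (k,a) $ (l,b) = - c * (Omega ** H ** Omega) $ (k,a) $ (l,b)" for k l a b
  proof -
    have "sld_op hbar (direct_sum (\<lambda>k. \<nu> k *\<^sub>R mat 1)) H $ (k,a) $ (l,b) = 0"
      by (simp add: zero)
    then show ?thesis by (simp add: sld_op_def diagonal_mult_nth c_def algebra_simps)
  qed
  \<comment> \<open>Here \<open>x\<close> and \<open>y\<close> are partner entries and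
    \<open>s\<close> is the sign of their exchange. Substituting one equation into the other leaves
    \<open>s * s = 1\<close>, so one argument serves both signs.\<close>
  have vanish: "x = 0" if "\<nu> k * \<nu> l * x = s * c * y" "\<nu> k * \<nu> l * y = s * c * x" "s = 1 \<or> s = - 1"
    for x y s k l
  proof -
    have "(\<nu> k * \<nu> l)\<^sup>2 * x = c\<^sup>2 * x"
    proof -
      have "(\<nu> k * \<nu> l)\<^sup>2 * x = \<nu> k * \<nu> l * (s * c * y)"
        using that(1) by (simp add: power2_eq_square algebra_simps)
      also have "\<dots> = s * c * (s * c * x)"
        using that(2) by (simp add: algebra_simps)
      also have "\<dots> = c\<^sup>2 * x" using that(3) by (auto simp: power2_eq_square)
      finally show ?thesis .
    qed
    moreover have "c\<^sup>2 < (\<nu> k * \<nu> l)\<^sup>2"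
      using gt c0 by (simp add: power_strict_mono)
    ultimately show ?thesis by simp
  qed
  have "H $ (k,a) $ (l,b) = 0" for k l a b
  proof -
    \<comment> \<open>In each block the two diagonal entries are partners with sign 1, and the two
      off-diagonal entries are partners with sign -1.\<close>
    have "H $ (k,1) $ (l,1) = 0"
      by (rule vanish[of k l _ 1 "H $ (k,2) $ (l,2)"]) (simp_all add: nth mult_Omega_nth Omega_mult_nth)
    moreover have "H $ (k,2) $ (l,2) = 0"
      by (rule vanish[of k l _ 1 "H $ (k,1) $ (l,1)"]) (simp_all add: nth mult_Omega_nth Omega_mult_nth)
    moreover have "H $ (k,1) $ (l,2) = 0"
      by (rule vanish[of k l _ "-1" "H $ (k,2) $ (l,1)"]) (simp_all add: nth mult_Omega_nth Omega_mult_nth)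
    moreover have "H $ (k,2) $ (l,1) = 0"
      by (rule vanish[of k l _ "-1" "H $ (k,1) $ (l,2)"]) (simp_all add: nth mult_Omega_nth Omega_mult_nth)
    ultimately show ?thesis using exhaust_2[of a] exhaust_2[of b] by auto
  qed
  then show ?thesis by (auto simp: vec_eq_iff)
qed

text \<open>Multiplying the symplectic relation on the right by \<open>- Omega\<close> and using
  \<open>Omega ** Omega = - mat 1\<close> exhibits a right inverse, which suffices for a square
  matrix.\<close>

lemma invertible_symplectic:
  fixes W :: "'n::finite mode_matrix"
  assumes "W ** Omega ** transpose W = Omega"
  shows "invertible W"
proof -
  have "W ** (- (Omega ** transpose W ** Omega)) = mat 1"
    using assms by (simp add: matrix_mul_assoc matrix_mult_minus_right Omega_Omega)
  then show ?thesis using invertible_right_inverse by blast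
qed

lemma bij_sld_op:
  fixes \<Sigma> :: "'n::finite mode_matrix"
  assumes "0 < hbar" "\<Sigma> \<in> MQ_int hbar"
  shows "bij (sld_op hbar \<Sigma>)"
proof -
  obtain \<nu> and W :: "'n mode_matrix" where nu: "\<And>k. hbar / 2 < \<nu> k"
    and W: "W ** Omega ** transpose W = Omega"
    and \<Sigma>: "\<Sigma> = W ** direct_sum (\<lambda>k. \<nu> k *\<^sub>R mat 1) ** transpose W"
    using assms(2) unfolding MQ_int_def symplectic_eigenvalues_def by blast
  let ?D = "direct_sum (\<lambda>k. \<nu> k *\<^sub>R mat 1)"
  obtain V where V: "W ** V = mat 1" "V ** W = mat 1"
    using invertible_symplectic[OF W] by (auto simp: invertible_def)
  then have tV: "transpose W ** transpose V = mat 1" "transpose V ** transpose W = mat 1"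
    by (simp_all add: matrix_transpose_mul[symmetric])
  have cancelW: "H = 0" if "W ** H ** transpose W = 0" for H
  proof -
    have "V ** (W ** H ** transpose W) ** transpose V = (V ** W) ** H ** (transpose W ** transpose V)"
      by (simp only: matrix_mul_assoc)
    with that V tV show ?thesis by simp
  qed
  have "G = 0" if "sld_op hbar \<Sigma> G = 0" for G
  proof -
    define H where "H = transpose W ** G ** W"
    have "\<Sigma> ** G ** \<Sigma> = W ** (?D ** H ** ?D) ** transpose W"
      by (simp add: \<Sigma> H_def matrix_mul_assoc)
    \<comment> \<open>Replacing each \<open>Omega\<close> by its symplectic congruence lets the same
      outer factors \<open>W\<close> and \<open>transpose W\<close> come out of both terms of the
      operator.\<close>
    moreover have "Omega ** G ** Omega = (W ** Omega ** transpose W) ** G ** (W ** Omega ** transpose W)"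
      by (simp add: W)
    then have "Omega ** G ** Omega = W ** (Omega ** H ** Omega) ** transpose W"
      by (simp add: H_def matrix_mul_assoc)
    ultimately have "sld_op hbar \<Sigma> G = W ** sld_op hbar ?D H ** transpose W"
      by (simp add: sld_op_def matrix_add_ldistrib matrix_add_rdistrib matrix_scalar_ac
        scalar_matrix_assoc[symmetric])
    then have "sld_op hbar ?D H = 0" using that cancelW by simp
    then have "H = 0" using inj_sld_op_diagonal nu assms(1) by blast
    \<comment> \<open>Undoes the congruence that defines \<open>H\<close>, with \<open>V\<close> the
      inverse of \<open>W\<close>.\<close>
    have "G = (transpose V ** transpose W) ** G ** (W ** V)" by (simp add: V tV)
    also have "\<dots> = transpose V ** H ** V" by (simp add: H_def matrix_mul_assoc)
    finally show "G = 0" by (simp add: \<open>H = 0\<close>)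
  qed
  then have "inj (sld_op hbar \<Sigma>)"
    using linear_sld_op linear_injective_0 by blast
  then show ?thesis
    using linear_injective_imp_surjective[OF linear_sld_op] by (simp add: bij_def)
qed

lemma bij_betw_sld_op_Sym:
  assumes "0 < hbar" "\<Sigma> \<in> MQ_int hbar"
  shows "bij_betw (sld_op hbar \<Sigma>) Sym Sym"
proof -
  have inj: "inj (sld_op hbar \<Sigma>)" and surj: "surj (sld_op hbar \<Sigma>)"
    using bij_sld_op[OF assms] by (auto simp: bij_def)
  have \<Sigma>: "\<Sigma> \<in> Sym" using assms(2) by (simp add: MQ_int_def MQ_def SymPD_def)
  \<comment> \<open>If the image of \<open>G\<close> is symmetric, then \<open>G\<close> and
    \<open>transpose G\<close> have the same image, and injectivity identifies them. Hence preimages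
    of symmetric matrices are symmetric, which gives surjectivity onto \<open>Sym\<close>.\<close>
  have "sld_op hbar \<Sigma> G \<in> Sym \<longleftrightarrow> G \<in> Sym" for G
    using inj_eq[OF inj, of "transpose G" G] by (simp add: Sym_def transpose_sld_op[OF \<Sigma>])
  moreover have "\<exists>G. X = sld_op hbar \<Sigma> G" for X using surj by (rule surjD)
  ultimately have "sld_op hbar \<Sigma> ` Sym = Sym"
    by (auto simp: image_iff) metis
  then show ?thesis using inj by (auto simp: bij_betw_def intro: inj_on_subset)
qed

section \<open>Trace pairing, Bures metric and duality\<close>

lemma trace_scaleR: "trace (c *\<^sub>R A) = c * trace A"
  by (simp add: trace_def sum_distrib_left)

text \<open>Makes the trace pairing positive definite on \<open>Sym\<close>; uniqueness of the dual
  vector rests on this.\<close>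

lemma trace_mult_self_Sym:
  assumes "A \<in> Sym"
  shows "trace (A ** A) = A \<bullet> A"
proof -
  have "A $ i $ j = A $ j $ i" for i j
    using assms by (auto simp: Sym_def transpose_def vec_eq_iff)
  then show ?thesis
    by (simp add: trace_def matrix_matrix_mult_def inner_vec_def)
qed

lemma trace_sld_op:
  "trace (A ** sld_op hbar \<Sigma> B)
    = trace (A ** \<Sigma> ** B ** \<Sigma>) + hbar\<^sup>2 / 4 * trace (A ** Omega ** B ** Omega)"
  by (simp add: sld_op_def matrix_add_ldistrib matrix_scalar_ac scalar_matrix_assoc[symmetric]
      trace_add trace_scaleR matrix_mul_assoc)

text \<open>Cyclicity of the trace exchanges \<open>A\<close> and \<open>B\<close> in the trace of
  \<open>A ** M ** B ** M\<close>; this is applied with \<open>M\<close> equal to \<Sigma> and to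
  \<open>Omega\<close>.\<close>

lemma trace_sld_op_commute: "trace (sld_op hbar \<Sigma> A ** B) = trace (A ** sld_op hbar \<Sigma> B)"
proof -
  have swap: "trace (B ** M ** A ** M) = trace (A ** M ** B ** M)" for M
    using trace_mul_sym[of "B ** M" "A ** M"] by (simp add: matrix_mul_assoc)
  show ?thesis
    by (simp add: trace_mul_sym[of "sld_op hbar \<Sigma> A" B] trace_sld_op swap)
qed

text \<open>The affine family has partial derivatives \<open>X\<close> and \<open>Y\<close> at 0,
  and the factors 1/4 and 1/2 combine to 1/8. The definite description is resolved only later, by
  bijectivity on \<open>Sym\<close>.\<close>

lemma bures_metric_eq_THE:
  "bures_metric hbar \<Sigma> X Y = 1 / 8 * trace ((THE G. G \<in> Sym \<and> sld_op hbar \<Sigma> G = X) ** Y)"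
proof -
  let ?\<sigma> = "\<lambda>\<theta> :: real ^ 2. \<Sigma> + \<theta> $ 1 *\<^sub>R X + \<theta> $ 2 *\<^sub>R Y"
  have lin: "vector_derivative (\<lambda>t. \<Sigma> + t *\<^sub>R Z) (at 0) = Z" for Z
    by (rule vector_derivative_at) (auto intro!: derivative_eq_intros)
  have "partial_deriv 1 ?\<sigma> 0 = X" "partial_deriv 2 ?\<sigma> 0 = Y"
    using lin by (simp_all add: partial_deriv_def axis_def)
  then show ?thesis
    by (simp add: bures_metric_def bures_components_def qfi_def gain_def)
qed

text \<open>Confirms that the form defined by affine families gives the components of any family:
  both sides see only its value and first derivatives at the base point.\<close>

lemma bures_components_eq_metric:
  "bures_components hbar \<sigma> \<theta> i j =
     bures_metric hbar (\<sigma> \<theta>) (partial_deriv i \<sigma> \<theta>) (partial_deriv j \<sigma> \<theta>)"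
  by (simp add: bures_metric_eq_THE bures_components_def qfi_def gain_def)

text \<open>Injectivity on \<open>Sym\<close> makes \<open>c *\<^sub>R G\<close> the gain matrix of
  the first argument. The case \<open>c = 1\<close> gives the metric formula, and
  \<open>c = 8\<close> treats the dual vector.\<close>

lemma bures_metric_sld_op:
  assumes "bij_betw (sld_op hbar \<Sigma>) Sym Sym" "G \<in> Sym"
  shows "bures_metric hbar \<Sigma> (c *\<^sub>R sld_op hbar \<Sigma> G) Y = c / 8 * trace (G ** Y)"
proof -
  have "sld_op hbar \<Sigma> (c *\<^sub>R G) = c *\<^sub>R sld_op hbar \<Sigma> G"
    by (rule linear_cmul[OF linear_sld_op])
  moreover have "c *\<^sub>R G \<in> Sym" using assms(2) by (simp add: Sym_def transpose_scalar)
  ultimately have "(THE G'. G' \<in> Sym \<and> sld_op hbar \<Sigma> G' = c *\<^sub>R sld_op hbar \<Sigma> G) = c *\<^sub>R G"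
    using assms(1) by (intro the_equality) (auto simp: bij_betw_def inj_on_def)
  then show ?thesis
    by (simp add: bures_metric_eq_THE scalar_matrix_assoc[symmetric] trace_scaleR)
qed

lemma is_bures_dual_iff:
  assumes "bij_betw (sld_op hbar \<Sigma>) Sym Sym" "P \<in> Sym"
  shows "is_bures_dual hbar \<Sigma> P X \<longleftrightarrow> X = 8 *\<^sub>R sld_op hbar \<Sigma> P"
proof
  assume "X = 8 *\<^sub>R sld_op hbar \<Sigma> P"
  moreover have "sld_op hbar \<Sigma> P \<in> Sym" using assms by (auto simp: bij_betw_def)
  ultimately show "is_bures_dual hbar \<Sigma> P X"
    using bures_metric_sld_op[OF assms, of 8] by (simp add: is_bures_dual_def Sym_def transpose_scalar)
next
  assume dual: "is_bures_dual hbar \<Sigma> P X"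
  then obtain G where G: "G \<in> Sym" "X = sld_op hbar \<Sigma> G"
    using assms(1) by (auto simp: is_bures_dual_def bij_betw_def)
  \<comment> \<open>Duality says that \<open>A\<close> is trace-orthogonal to every symmetric
    matrix. Testing against \<open>A\<close> itself forces \<open>A = 0\<close>.\<close>
  define A where "A = (1 / 8) *\<^sub>R G - P"
  have A: "A \<in> Sym"
    using G assms(2) by (simp add: A_def Sym_def transpose_scalar transpose_def vec_eq_iff)
  have "1 / 8 * trace (G ** A) = trace (P ** A)"
    using bures_metric_sld_op[OF assms(1) G(1), of 1 A] dual A G by (simp add: is_bures_dual_def)
  then have "trace (A ** A) = 0"
    \<comment> \<open>Only the left factor \<open>A\<close> is expanded, so that the traces match
      the preceding identity.\<close>
    by (simp add: A_def[THEN arg_cong, of "\<lambda>Z. trace (Z ** A)"] matrix_sub_rdistrib trace_sub 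
       scalar_matrix_assoc[symmetric] trace_scaleR)
  then have "A = 0" using trace_mult_self_Sym[OF A] by simp
  then have "P = (1 / 8) *\<^sub>R G" by (simp add: A_def)
  then have "G = 8 *\<^sub>R P" by simp
  then show "X = 8 *\<^sub>R sld_op hbar \<Sigma> P"
    using G(2) linear_cmul[OF linear_sld_op] by simp
qed

theorem mainTheorem1:
  fixes hbar :: real and \<Sigma> :: "real ^ ('n::finite \<times> 2) ^ ('n \<times> 2)"
  assumes "0 < hbar" and "\<Sigma> \<in> MQ_int hbar"
  shows
    "linear (sld_op hbar \<Sigma>) \<and>
     bij_betw (sld_op hbar \<Sigma>) Sym Sym \<and>
     (\<forall>A\<in>Sym. \<forall>B\<in>Sym. trace (sld_op hbar \<Sigma> A ** B) = trace (A ** sld_op hbar \<Sigma> B)) \<and>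
     (\<forall>X\<in>Sym. \<forall>Y\<in>Sym.
        bures_metric hbar \<Sigma> X Y = 1 / 8 * trace (inv_into Sym (sld_op hbar \<Sigma>) X ** Y)) \<and>
     (\<forall>U (\<sigma> :: real ^ 'p::finite \<Rightarrow> real ^ ('n \<times> 2) ^ ('n \<times> 2)). \<forall>\<theta>\<in>U. \<forall>i j.
        open U \<and> smooth_on U \<sigma> \<and> \<sigma> ` U \<subseteq> MQ_int hbar \<and> \<sigma> \<theta> = \<Sigma> \<longrightarrow>
        bures_components hbar \<sigma> \<theta> i j =
          bures_metric hbar \<Sigma> (partial_deriv i \<sigma> \<theta>) (partial_deriv j \<sigma> \<theta>)) \<and>
     (\<forall>P\<in>Sym.
        (\<exists>!X. is_bures_dual hbar \<Sigma> P X) \<and>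
        bures_dual hbar \<Sigma> P = 8 *\<^sub>R sld_op hbar \<Sigma> P \<and>
        bures_cometric hbar \<Sigma> P P =
          8 * trace (P ** \<Sigma> ** P ** \<Sigma>) + 2 * hbar\<^sup>2 * trace (P ** Omega ** P ** Omega))"
proof (intro conjI ballI allI impI)
  show bij: "bij_betw (sld_op hbar \<Sigma>) Sym Sym"
    by (rule bij_betw_sld_op_Sym[OF assms])
  show "linear (sld_op hbar \<Sigma>)" by (rule linear_sld_op)
  show "trace (sld_op hbar \<Sigma> A ** B) = trace (A ** sld_op hbar \<Sigma> B)" for A B
    by (rule trace_sld_op_commute)
  show "bures_metric hbar \<Sigma> X Y = 1 / 8 * trace (inv_into Sym (sld_op hbar \<Sigma>) X ** Y)"
    if "X \<in> Sym" for X Y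
    using bures_metric_sld_op[OF bij, of "inv_into Sym (sld_op hbar \<Sigma>) X" 1] that bij
    by (simp add: bij_betw_def inv_into_into f_inv_into_f)
  show "bures_components hbar \<sigma> \<theta> i j =
      bures_metric hbar \<Sigma> (partial_deriv i \<sigma> \<theta>) (partial_deriv j \<sigma> \<theta>)"
    if "open U \<and> smooth_on U \<sigma> \<and> \<sigma> ` U \<subseteq> MQ_int hbar \<and> \<sigma> \<theta> = \<Sigma>"
    for U and \<sigma> :: "real ^ 'p \<Rightarrow> 'n mode_matrix" and \<theta> i j
    using that bures_components_eq_metric[of hbar \<sigma> \<theta> i j] by simp
  fix P :: "'n mode_matrix"
  assume P: "P \<in> Sym"
  show "\<exists>!X. is_bures_dual hbar \<Sigma> P X"
    by (simp add: is_bures_dual_iff[OF bij P])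
  show dual: "bures_dual hbar \<Sigma> P = 8 *\<^sub>R sld_op hbar \<Sigma> P"
    by (simp add: bures_dual_def is_bures_dual_iff[OF bij P])
  show "bures_cometric hbar \<Sigma> P P =
      8 * trace (P ** \<Sigma> ** P ** \<Sigma>) + 2 * hbar\<^sup>2 * trace (P ** Omega ** P ** Omega)"
    \<comment> \<open>The metric formula with \<open>c = 8\<close> cancels the factor 1/8. The
      factor 8 in the second argument remains and turns \<open>hbar\<^sup>2 / 4\<close> into
      \<open>2 * hbar\<^sup>2\<close>.\<close>
    by (simp add: bures_cometric_def dual bures_metric_sld_op[OF bij P] matrix_scalar_ac
        scalar_matrix_assoc[symmetric] trace_scaleR trace_sld_op)
qed

end
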